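(* Let $q\in\{3,4\}$. For any mass distribution $\mu$ on $\mathbb{R}^4=\mathbb{C}^2$, there exists a pair of complex orthogonal complex regular $q$-fans in $\mathbb{R}^4$, each of which equipartitions $\mu$.
   Context: A mass distribution on $\mathbb{R}^4$ is a finite (nonnegative) measure that is absolutely continuous with respect to Lebesgue measure. Let $\langle\mathbf z,\mathbf a\rangle_{\mathbb{C}}=\sum_i z_i\bar a_i$ be the standard Hermitian form on $\mathbb{C}^2$. A complex regular $q$-fan in $\mathbb{R}^4=\mathbb{C}^2$ is a set of the form $\{\mathbf z\in\mathbb{C}^2\mid \langle\mathbf z,\mathbf a\rangle_{\mathbb{C}}=\bar b+v \text{ with } v=0 \text{ or } \arg(v)=2\pi j/q \text{ for some } 0\le j<q\}$, where $\mathbf a\in\mathbb{C}^2$ is a unit vector and $b\in\mathbb{C}$; its regular $q$-sectors are $S_j=\{\mathbf z\mid\langle\mathbf z,\mathbf a\rangle_{\mathbb{C}}=\bar b+v,\ v=0\text{ or }\arg(v)\in[2\pi j/q,2\pi(j+1)/q]\}$, $0\le j<q$. It equipartitions $\mu$ if $\mu(S_j)=\frac1q\mu(\mathbb{R}^4)$ for every $0\le j<q$. Two complex regular $q$-fans with normal vectors $\mathbf a,\mathbf a'$ are complex orthogonal if $\langle\mathbf a,\mathbf a'\rangle_{\mathbb{C}}=0$. *)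

theory Defs
  imports "HOL-Analysis.Analysis"
begin

text \<open>
  \<open>\<real>\<^sup>4 = \<complex>\<^sup>2\<close> is the type \<^typ>\<open>complex^2\<close>, a Euclidean space of real dimension 4, so that
  \<^term>\<open>lborel :: (complex^2) measure\<close> is 4-dimensional Lebesgue measure (on Borel sets) and
  \<^term>\<open>norm :: complex^2 \<Rightarrow> real\<close> is the norm of the standard Hermitian form.
\<close>

definition mass_distribution :: "'a::euclidean_space measure \<Rightarrow> bool" where
  "mass_distribution \<mu> \<longleftrightarrow>
     finite_measure \<mu> \<and> sets \<mu> = sets borel \<and> absolutely_continuous lborel \<mu>"

definition hermitian_form :: "complex^2 \<Rightarrow> complex^2 \<Rightarrow> complex" where
  "hermitian_form z a = (\<Sum>i\<in>UNIV. z $ i * cnj (a $ i))"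

text \<open>
  Arguments are taken modulo \<open>2\<pi>\<close>, i.e. through the relation \<^const>\<open>is_Arg\<close>: with a principal
  argument in \<open>[0, 2\<pi>)\<close>, the sector with \<open>j = q - 1\<close> would lose one of its two bounding half-hyperplanes.
\<close>

definition regular_fan_set :: "nat \<Rightarrow> complex^2 \<Rightarrow> complex \<Rightarrow> (complex^2) set" where
  "regular_fan_set q a b =
     {z. \<exists>v. hermitian_form z a = cnj b + v \<and>
             (v = 0 \<or> (\<exists>j<q. is_Arg v (2 * pi * real j / real q)))}"

definition regular_sector :: "nat \<Rightarrow> complex^2 \<Rightarrow> complex \<Rightarrow> nat \<Rightarrow> (complex^2) set" where
  "regular_sector q a b j =
     {z. \<exists>v. hermitian_form z a = cnj b + v \<and>
             (v = 0 \<or> (\<exists>\<theta>\<in>{2 * pi * real j / real q .. 2 * pi * real (j + 1) / real q}. is_Arg v \<theta>))}"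

text \<open>
  A fan is kept together with its data: unit normal vector \<open>a\<close> and offset \<open>b\<close>. The set \<open>F\<close> alone
  determines these (for \<open>q \<ge> 3\<close>) only up to a common \<open>q\<close>-th root of unity, which permutes the
  sectors cyclically.
\<close>

definition complex_regular_fan ::
    "nat \<Rightarrow> (complex^2) set \<Rightarrow> complex^2 \<Rightarrow> complex \<Rightarrow> bool" where
  "complex_regular_fan q F a b \<longleftrightarrow> norm a = 1 \<and> F = regular_fan_set q a b"

definition equipartitions ::
    "nat \<Rightarrow> complex^2 \<Rightarrow> complex \<Rightarrow> (complex^2) measure \<Rightarrow> bool" where
  "equipartitions q a b \<mu> \<longleftrightarrow>
     (\<forall>j<q. measure \<mu> (regular_sector q a b j) = 1 / real q * measure \<mu> UNIV)"

definition complex_orthogonal :: "complex^2 \<Rightarrow> complex^2 \<Rightarrow> bool" where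
  "complex_orthogonal a a' \<longleftrightarrow> hermitian_form a a' = 0"

end

theory Submission
  imports Defs
begin

text \<open>
  The two coordinate functionals of \<open>\<complex>\<^sup>2\<close> are Hermitian products with orthogonal vectors, and they stay so
  after multiplying the vectors by phases. Hence it suffices to treat each push-forward
  \<open>\<nu>\<close> of \<open>\<mu>\<close> under a coordinate separately: it is a finite measure on the plane for which all lines are null, and it
  has to be equipartitioned by some planar \<open>q\<close>-fan, whose direction is free.

  For \<open>q = 3\<close> the direction is fixed and the apex \<open>p\<close> moves. With \<open>u\<^sub>0, u\<^sub>1, u\<^sub>2\<close> the unit bisectors of the sectors,
  the field \<open>G p = \<Sum>\<^sub>j \<nu>(p + S\<^sub>j) u\<^sub>j\<close> is continuous and points towards the origin far out, so it has a zero by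
  Brouwer's theorem; as \<open>u\<^sub>0 + u\<^sub>1 + u\<^sub>2 = 0\<close> is the only linear relation, the sectors have equal measure there.

  For \<open>q = 4\<close> take in every direction a pair of perpendicular halving lines. Opposite quadrants then have equal
  measure, and a quarter turn exchanges the two values, so by connectedness they agree for some direction.
  The halving lines need not be unique, but two parallel ones bound a null strip.
\<close>

section \<open>Finite measures on the plane for which every line is null\<close>

locale line_null_measure = finite_measure \<nu> for \<nu> :: "complex measure" +
  assumes sets_eq [measurable_cong, simp]: "sets \<nu> = sets borel"
    and AE_off_line: "k \<noteq> 0 \<Longrightarrow> AE w in \<nu>. Re (k * w) \<noteq> d"
begin

lemma space_UNIV [simp]: "space \<nu> = UNIV"
  using sets_eq_imp_space_eq[OF sets_eq] by simp

text \<open>The two closed half-planes overlap only in the line \<open>Re (k * w) = d\<close>, which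
  is null. As \<open>k\<close> runs through the nonzero numbers all lines occur, and turning a line
  becomes multiplying \<open>k\<close> by a phase.\<close>

lemma measure_split_line:
  assumes k: "k \<noteq> 0" and [measurable]: "Measurable.pred borel P"
  shows "measure \<nu> {w. P w \<and> d \<le> Re (k * w)} + measure \<nu> {w. P w \<and> Re (k * w) \<le> d}
    = measure \<nu> {w. P w}"
proof -
  have "measure \<nu> ({w. P w \<and> d \<le> Re (k * w)} \<union> {w. P w \<and> Re (k * w) \<le> d})
     = measure \<nu> {w. P w \<and> d \<le> Re (k * w)} + measure \<nu> {w. P w \<and> Re (k * w) \<le> d}"
    using AE_off_line[OF k, of d]
    by (intro measure_Un_AE) (auto simp: fmeasurable_eq_sets)
  moreover have "{w. P w \<and> d \<le> Re (k * w)} \<union> {w. P w \<and> Re (k * w) \<le> d} = {w. P w}"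
    by auto
  ultimately show ?thesis by simp
qed

text \<open>Dominated convergence along a sequence of parameters: a point off both boundary lines of
  the limit region is eventually always inside or always outside the moving region, and the boundary
  lines are null. Two half-planes are what a sector needs; a single one is the case where both
  coincide.\<close>

lemma continuous_on_measure_two_halfplanes:
  fixes a b :: "'x::metric_space \<Rightarrow> complex" and c d :: "'x \<Rightarrow> real"
  assumes cont: "continuous_on X a" "continuous_on X b" "continuous_on X c" "continuous_on X d"
    and nz: "\<And>x. x \<in> X \<Longrightarrow> a x \<noteq> 0" "\<And>x. x \<in> X \<Longrightarrow> b x \<noteq> 0"
  shows "continuous_on X
    (\<lambda>x. measure \<nu> {w. c x \<le> Re (a x * w) \<and> d x \<le> Re (b x * w)})"
proof -
  define S where "S x = {w. c x \<le> Re (a x * w) \<and> d x \<le> Re (b x * w)}" for x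
  have [measurable]: "S x \<in> sets borel" for x
    unfolding S_def by measurable
  have "(\<lambda>n. measure \<nu> (S (s n))) \<longlonglongrightarrow> measure \<nu> (S x)"
    if s: "\<And>n. s n \<in> X" "x \<in> X" "s \<longlonglongrightarrow> x" for s x
  proof -
    \<comment> \<open>One composition rule for limits along \<open>s\<close>, to be applied to
      \<open>a\<close>, \<open>b\<close>, \<open>c\<close> and \<open>d\<close> alike.\<close>
    note tends = continuous_on_tendsto_compose[OF _ s(3) s(2) always_eventually, OF _ allI, OF _ s(1)]
    have "(\<lambda>n. \<integral>w. indicat_real (S (s n)) w \<partial>\<nu>) \<longlonglongrightarrow> (\<integral>w. indicat_real (S x) w \<partial>\<nu>)"
    proof (rule integral_dominated_convergence[where w = "\<lambda>_. 1"])
      show "AE w in \<nu>. (\<lambda>n. indicat_real (S (s n)) w) \<longlonglongrightarrow> indicat_real (S x) w"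
        using AE_off_line[OF nz(1)[OF s(2)], of "c x"] AE_off_line[OF nz(2)[OF s(2)], of "d x"]
      proof eventually_elim
        case (elim w)
        have 1: "(\<lambda>n. Re (a (s n) * w) - c (s n)) \<longlonglongrightarrow> Re (a x * w) - c x"
          by (intro tendsto_intros tends cont)
        have 2: "(\<lambda>n. Re (b (s n) * w) - d (s n)) \<longlonglongrightarrow> Re (b x * w) - d x"
          by (intro tendsto_intros tends cont)
        have "\<forall>\<^sub>F n in sequentially. (w \<in> S (s n)) = (w \<in> S x)"
        proof -
          consider "Re (a x * w) - c x < 0" | "Re (b x * w) - d x < 0"
            | "Re (a x * w) - c x > 0" "Re (b x * w) - d x > 0"
            using elim by linarith
          then show ?thesis
          proof cases
            case 1
            with order_tendstoD(2)[OF \<open>(\<lambda>n. Re (a (s n) * w) - c (s n)) \<longlonglongrightarrow> _\<close> 1]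
            show ?thesis by (auto elim!: eventually_mono simp: S_def)
          next
            case 2
            with order_tendstoD(2)[OF \<open>(\<lambda>n. Re (b (s n) * w) - d (s n)) \<longlonglongrightarrow> _\<close> 2]
            show ?thesis by (auto elim!: eventually_mono simp: S_def)
          next
            case 3
            have "\<forall>\<^sub>F n in sequentially. w \<in> S (s n)"
              using order_tendstoD(1)[OF 1 3(1)] order_tendstoD(1)[OF 2 3(2)]
              by eventually_elim (auto simp: S_def)
            moreover have "w \<in> S x" using 3 by (auto simp: S_def)
            ultimately show ?thesis by (auto elim!: eventually_mono)
          qed
        qed
        then show ?case
          by (intro tendsto_eventually) (auto elim!: eventually_mono simp: indicator_def)
      qed
    qed (auto simp: indicator_def)
    then show ?thesis by simp
  qed
  then show ?thesis
    unfolding S_def[symmetric] continuous_on_sequentially by (auto simp: o_def)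
qed

text \<open>Balls of integer radius exhaust the plane, so their measures converge to the total mass.
  The resulting ball confines the halving lines for \<open>q = 4\<close> and makes the field point
  inward for \<open>q = 3\<close>.\<close>

lemma ex_ball_measure_gt:
  assumes "c < measure \<nu> UNIV"
  obtains r :: real where "0 < r" "c < measure \<nu> (ball 0 r)"
proof -
  have "(\<lambda>n. measure \<nu> (ball 0 (real n))) \<longlonglongrightarrow> measure \<nu> (\<Union>n. ball 0 (real n))"
    by (intro finite_Lim_measure_incseq) (auto simp: incseq_def)
  moreover have "(\<Union>n. ball (0::complex) (real n)) = UNIV"
    using reals_Archimedean2 by auto
  ultimately have "\<forall>\<^sub>F n in sequentially. c < measure \<nu> (ball 0 (real n))"
    using order_tendstoD(1) assms by metis
  moreover have "\<forall>\<^sub>F n in sequentially. 0 < n"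
    by (rule eventually_gt_at_top)
  ultimately have "\<forall>\<^sub>F n in sequentially. 0 < real n \<and> c < measure \<nu> (ball 0 (real n))"
    by eventually_elim auto
  then show thesis
    using that eventually_happens'[OF sequentially_bot] by blast
qed

section \<open>Four quadrants: turning a pair of perpendicular halving lines\<close>

lemma ex_perpendicular_lines_equipartition:
  defines "m \<equiv> measure \<nu> UNIV"
  shows "\<exists>t p. measure \<nu> {w. 0 \<le> Re (cis t * w - p) \<and> 0 \<le> Im (cis t * w - p)} = m / 4
    \<and> measure \<nu> {w. Re (cis t * w - p) \<le> 0 \<and> 0 \<le> Im (cis t * w - p)} = m / 4
    \<and> measure \<nu> {w. Re (cis t * w - p) \<le> 0 \<and> Im (cis t * w - p) \<le> 0} = m / 4
    \<and> measure \<nu> {w. 0 \<le> Re (cis t * w - p) \<and> Im (cis t * w - p) \<le> 0} = m / 4"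
proof (cases "m = 0")
  case True
  then have "measure \<nu> A = 0" for A
    by (metis m_def bounded_measure measure_nonneg order_antisym space_UNIV)
  then show ?thesis using True by simp
next
  case False
  then have m: "m > 0" by (simp add: m_def zero_less_measure_iff)
  \<comment> \<open>A half-plane that misses this ball has less than half of the mass, and one that
    contains it has more. Hence halving lines have offsets between \<open>- r\<close> and
    \<open>r\<close>, whatever their direction.\<close>
  obtain r where r: "r > 0" "m / 2 < measure \<nu> (ball 0 r)"
    using ex_ball_measure_gt[of "m / 2"] m by (auto simp: m_def)
  \<comment> \<open>The imaginary part is the real part after a quarter turn back, so
    \<open>H\<close> and its continuity cover both families of lines.\<close>
  have Im_cis: "Im (cis t * w) = Re (cis (t - pi / 2) * w)" for t w
    by (simp add: cos_diff sin_diff)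
  note times_complex.sel [simp del]
  define H where "H t x = measure \<nu> {w. x \<le> Re (cis t * w)}" for t x
  define N where "N t x y = measure \<nu> {w. x \<le> Re (cis t * w) \<and> y \<le> Im (cis t * w)}" for t x y
  have Im_H: "measure \<nu> {w. y \<le> Im (cis t * w)} = H (t - pi / 2) y" for t y
    unfolding H_def Im_cis ..
  have contH: "continuous_on UNIV (\<lambda>z. H (fst z) (snd z))"
    using continuous_on_measure_two_halfplanes[of UNIV "\<lambda>z. cis (fst z)" "\<lambda>z. cis (fst z)" snd snd]
    by (simp add: H_def continuous_intros)
  have contN: "continuous_on UNIV (\<lambda>z. N (fst z) (fst (snd z)) (snd (snd z)))"
    unfolding N_def Im_cis
    by (intro continuous_on_measure_two_halfplanes continuous_intros) auto
  have H_compl: "H t x + measure \<nu> {w. Re (cis t * w) \<le> x} = m" for t x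
    using measure_split_line[of "cis t" "\<lambda>_. True" x] by (simp add: H_def m_def)
  have Re_cis_le: "\<bar>Re (cis t * w)\<bar> \<le> norm w" for t w
    using abs_Re_le_cmod[of "cis t * w"] by (simp only: norm_mult norm_cis mult_1)
  have H_small: "H t x < m / 2" if "x \<ge> r" for t x
  proof -
    have "{w. x \<le> Re (cis t * w)} \<subseteq> UNIV - ball 0 r"
    proof
      fix w assume "w \<in> {w. x \<le> Re (cis t * w)}"
      then have "r \<le> norm w"
        using that Re_cis_le[of t w] by (simp only: mem_Collect_eq)
      then show "w \<in> UNIV - ball 0 r" by simp
    qed
    then have "H t x \<le> measure \<nu> (UNIV - ball 0 r)"
      unfolding H_def by (auto intro!: finite_measure_mono)
    also have "\<dots> = m - measure \<nu> (ball 0 r)"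
      using finite_measure_compl[of "ball 0 r"] by (simp add: m_def)
    finally show ?thesis using r by linarith
  qed
  have H_large: "H t x > m / 2" if "x \<le> - r" for t x
  proof -
    have "ball 0 r \<subseteq> {w. x \<le> Re (cis t * w)}"
    proof
      fix w :: complex assume "w \<in> ball 0 r"
      then have "x \<le> Re (cis t * w)"
        using that Re_cis_le[of t w] by (simp only: mem_ball_0)
      then show "w \<in> {w. x \<le> Re (cis t * w)}" by simp
    qed
    then have "measure \<nu> (ball 0 r) \<le> H t x"
      unfolding H_def by (auto intro!: finite_measure_mono)
    then show ?thesis using r by linarith
  qed
  have ex_median: "\<exists>x. H t x = m / 2" for t
  proof -
    have "continuous_on {-r..r} (\<lambda>x. H t x)"
      using continuous_on_compose2[OF contH, of "{-r..r}" "\<lambda>x. (t, x)"] by (simp add: continuous_intros)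
    then show ?thesis
      using IVT2'[of "H t" r "m / 2" "- r"] H_small[of r t] H_large[of "- r" t] r by force
  qed
  define K where "K = {-r..r} \<times> {-r..r}"
  have K: "(x, y) \<in> K" if "H t x = m / 2" "H s y = m / 2" for t s x y
    using that H_small[of x t] H_large[of x t] H_small[of y s] H_large[of y s]
    by (force simp: K_def)
  define bal where "bal t x y \<longleftrightarrow> H t x = m / 2 \<and> H (t - pi / 2) y = m / 2" for t x y
  define T where "T = {0..pi / 2}"
  have clo: "closed {z. bal (fst z) (fst (snd z)) (snd (snd z)) \<and> N (fst z) (fst (snd z)) (snd (snd z)) \<in> C}"
    if "closed C" for C
  proof -
    have "closed {z. H (fst z) (fst (snd z)) = m / 2}"
      by (intro closed_Collect_eq continuous_on_compose2[OF contH, of _ "\<lambda>z. (fst z, fst (snd z))", simplified] continuous_intros)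
    moreover have "closed {z. H (fst z - pi / 2) (snd (snd z)) = m / 2}"
      by (intro closed_Collect_eq continuous_on_compose2[OF contH, of _ "\<lambda>z. (fst z - pi / 2, snd (snd z))", simplified] continuous_intros)
    moreover have "closed ((\<lambda>z. N (fst z) (fst (snd z)) (snd (snd z))) -` C)"
      using that contN by (rule closed_vimage)
    ultimately show ?thesis
      by (auto simp: bal_def vimage_def intro!: closed_Collect_conj)
  qed
  \<comment> \<open>Offsets of halving lines need not be unique, so \<open>N\<close> is not a
    function of the direction alone. The sets \<open>L C\<close> collect the directions in which
    some pair of halving lines has its first quadrant measure in \<open>C\<close>; their closedness
    replaces the continuity in an intermediate value argument.\<close>
  define L where "L C = {t \<in> T. \<exists>x y. bal t x y \<and> N t x y \<in> C}" for C
  have closed_L: "closed (L C)" if "closed C" for C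
  proof -
    let ?C = "(T \<times> K) \<inter> {z. bal (fst z) (fst (snd z)) (snd (snd z)) \<and> N (fst z) (fst (snd z)) (snd (snd z)) \<in> C}"
    \<comment> \<open>\<open>K\<close> contains the offsets of all halving lines, so
      \<open>L C\<close> will be the projection of a compact set.\<close>
    have "compact ?C"
      unfolding T_def K_def using clo[OF that] by (intro compact_Int_closed compact_Times) auto
    then have "compact (fst ` ?C)"
      by (intro compact_continuous_image continuous_intros)
    moreover have "fst ` ?C = L C"
    proof (intro set_eqI iffI)
      fix t assume "t \<in> L C"
      then obtain x y where xy: "t \<in> T" "bal t x y" "N t x y \<in> C" by (auto simp: L_def)
      then have "(x, y) \<in> K" using K[of t x "t - pi / 2" y] unfolding bal_def by blast
      with xy have "(t, x, y) \<in> ?C" by simp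
      then show "t \<in> fst ` ?C" by (rule image_eqI[rotated]) simp
    qed (auto simp: L_def)
    ultimately show ?thesis by (simp add: compact_imp_closed)
  qed
  have ex_bal: "\<exists>x y. bal t x y" for t
    using ex_median unfolding bal_def by blast
  \<comment> \<open>The two lines stay the same. The new first quadrant is the old fourth one, which
    completes the old first quadrant to a half-plane of measure \<open>m / 2\<close>.\<close>
  have turn: "bal (t + pi / 2) (- y) x" "N (t + pi / 2) (- y) x = m / 2 - N t x y" if "bal t x y" for t x y
  proof -
    have 1: "Re (cis (t + pi / 2) * w) = - Im (cis t * w)" "Im (cis (t + pi / 2) * w) = Re (cis t * w)" for w
      by (simp_all add: cos_add sin_add times_complex.sel)
    have "H (t + pi / 2) (- y) = measure \<nu> {w. Re (cis (t - pi / 2) * w) \<le> y}"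
      unfolding H_def 1 by (simp add: Im_cis)
    then show "bal (t + pi / 2) (- y) x"
      using that H_compl[of "t - pi / 2" y] by (simp add: bal_def)
    have "N (t + pi / 2) (- y) x = measure \<nu> {w. x \<le> Re (cis t * w) \<and> Re (cis (t - pi / 2) * w) \<le> y}"
      unfolding N_def 1 unfolding Im_cis by (simp add: conj_commute)
    moreover have "N t x y + measure \<nu> {w. x \<le> Re (cis t * w) \<and> Re (cis (t - pi / 2) * w) \<le> y} = H t x"
      unfolding N_def Im_cis H_def by (rule measure_split_line) auto
    ultimately show "N (t + pi / 2) (- y) x = m / 2 - N t x y"
      using that by (simp add: bal_def)
  qed
  let ?A = "L {m / 4..}" and ?B = "L {..m / 4}"
  obtain x0 y0 where bal0: "bal 0 x0 y0" using ex_bal by blast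
  note turn0 = turn[OF bal0]
  \<comment> \<open>By \<open>turn0\<close>, the values of \<open>N\<close> at the directions
    \<open>0\<close> and \<open>pi / 2\<close> add up to \<open>m / 2\<close>, so they lie on
    different sides of \<open>m / 4\<close> or both equal it.\<close>
  have "?A \<noteq> {} \<and> ?B \<noteq> {}"
  proof (cases "N 0 x0 y0 \<ge> m / 4")
    case True
    then have "0 \<in> ?A" "pi / 2 \<in> ?B"
      using bal0 turn0 m by (fastforce simp: L_def T_def)+
    then show ?thesis by blast
  next
    case False
    then have "0 \<in> ?B" "pi / 2 \<in> ?A"
      using bal0 turn0 m by (fastforce simp: L_def T_def)+
    then show ?thesis by blast
  qed
  moreover have "T \<subseteq> ?A \<union> ?B"
  proof
    fix t assume "t \<in> T"
    obtain x y where "bal t x y" using ex_bal by blast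
    then show "t \<in> ?A \<union> ?B" using \<open>t \<in> T\<close> linear[of "m / 4" "N t x y"] by (auto simp: L_def)
  qed
  moreover have "closed ?A" "closed ?B"
    by (simp_all add: closed_L)
  moreover have "?A \<subseteq> T" "?B \<subseteq> T" by (auto simp: L_def)
  moreover have "connected T" by (simp add: T_def)
  ultimately have "?A \<inter> ?B \<noteq> {}"
    using connected_closedD[of T ?A ?B] by blast
  \<comment> \<open>The common direction may come with two different pairs of halving lines, one on
    either side of \<open>m / 4\<close>; these have to be compared.\<close>
  then obtain t x y x' y' where b: "bal t x y" "bal t x' y'" "N t x y \<ge> m / 4" "N t x' y' \<le> m / 4"
    by (auto simp: L_def)
  \<comment> \<open>The strip between two parallel halving lines is null, so passing from one to the
    other does not lower \<open>N\<close>.\<close>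
  have Nx: "N t x y \<le> N t x' y" if "H t x = m / 2" "H t x' = m / 2" for x x' y
  proof -
    have "N t x y \<le> measure \<nu> ({w. x' \<le> Re (cis t * w) \<and> y \<le> Im (cis t * w)} \<union>
        ({w. x \<le> Re (cis t * w)} - {w. x' \<le> Re (cis t * w)}))"
      unfolding N_def by (intro finite_measure_mono) auto
    also have "\<dots> \<le> N t x' y + measure \<nu> ({w. x \<le> Re (cis t * w)} - {w. x' \<le> Re (cis t * w)})"
      unfolding N_def by (intro measure_Un_le) auto
    also have "measure \<nu> ({w. x \<le> Re (cis t * w)} - {w. x' \<le> Re (cis t * w)}) = 0"
    proof (cases "x \<le> x'")
      case True
      then have "measure \<nu> ({w. x \<le> Re (cis t * w)} - {w. x' \<le> Re (cis t * w)}) = H t x - H t x'"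
        unfolding H_def by (intro finite_measure_Diff) auto
      then show ?thesis using that by simp
    next
      case False
      then have "{w. x \<le> Re (cis t * w)} - {w. x' \<le> Re (cis t * w)} = {}" by auto
      then show ?thesis by (simp only: measure_empty)
    qed
    finally show ?thesis by simp
  qed
  have Ny: "N t x y \<le> N t x y'" if "H (t - pi / 2) y = m / 2" "H (t - pi / 2) y' = m / 2" for x y y'
  proof -
    have "N t x y \<le> measure \<nu> ({w. x \<le> Re (cis t * w) \<and> y' \<le> Im (cis t * w)} \<union>
        ({w. y \<le> Im (cis t * w)} - {w. y' \<le> Im (cis t * w)}))"
      unfolding N_def by (intro finite_measure_mono) auto
    also have "\<dots> \<le> N t x y' + measure \<nu> ({w. y \<le> Im (cis t * w)} - {w. y' \<le> Im (cis t * w)})"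
      unfolding N_def by (intro measure_Un_le) auto
    also have "measure \<nu> ({w. y \<le> Im (cis t * w)} - {w. y' \<le> Im (cis t * w)}) = 0"
    proof (cases "y \<le> y'")
      case True
      then have "measure \<nu> ({w. y \<le> Im (cis t * w)} - {w. y' \<le> Im (cis t * w)}) = H (t - pi / 2) y - H (t - pi / 2) y'"
        unfolding Im_H[symmetric] by (intro finite_measure_Diff) auto
      then show ?thesis using that by simp
    next
      case False
      then have "{w. y \<le> Im (cis t * w)} - {w. y' \<le> Im (cis t * w)} = {}" by auto
      then show ?thesis by (simp only: measure_empty)
    qed
    finally show ?thesis by simp
  qed
  have "N t x y \<le> N t x' y'"
    using Nx[of x x' y] Ny[of y y' x'] b by (simp add: bal_def)
  then have N4: "N t x y = m / 4" using b by linarith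
  \<comment> \<open>The other quadrants follow by subtraction from half-planes of measure
    \<open>m / 2\<close>.\<close>
  have s1: "measure \<nu> {w. x \<le> Re (cis t * w) \<and> Im (cis t * w) \<le> y} = m / 4"
    using measure_split_line[of "cis (t - pi / 2)" "\<lambda>w. x \<le> Re (cis t * w)" y] N4 b(1)
    by (simp add: N_def bal_def H_def Im_cis)
  have s2: "measure \<nu> {w. Re (cis t * w) \<le> x \<and> y \<le> Im (cis t * w)} = m / 4"
    using measure_split_line[of "cis t" "\<lambda>w. y \<le> Im (cis t * w)" x] N4 b(1) Im_H[of y t]
    by (simp add: N_def bal_def conj_commute)
  have "measure \<nu> {w. Re (cis t * w) \<le> x} = m / 2"
    using H_compl[of t x] b(1) by (simp add: bal_def)
  then have s3: "measure \<nu> {w. Re (cis t * w) \<le> x \<and> Im (cis t * w) \<le> y} = m / 4"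
    using measure_split_line[of "cis (t - pi / 2)" "\<lambda>w. Re (cis t * w) \<le> x" y] s2
    by (simp add: Im_cis)
  show ?thesis
    using N4 s1 s2 s3 by (intro exI[of _ t] exI[of _ "Complex x y"]) (simp add: N_def)
qed

end

section \<open>Two tools: sectors as intersections of half-planes, and zeros of inward
  fields\<close>

lemma is_Arg_iff_cis: "is_Arg v t \<longleftrightarrow> v = of_real (norm v) * cis t"
  by (simp add: is_Arg_def cis_conv_exp)

text \<open>If \<open>v\<close> has argument \<open>\<theta>\<close>, then
  \<open>Im (v * cis (- \<gamma>))\<close> is \<open>norm v * sin (\<theta> - \<gamma>)\<close>, so
  the two inequalities are sign conditions on sines. A width below \<open>pi\<close> keeps the
  angles in the range where the sign of the sine decides on which side of the boundary ray
  \<open>v\<close> lies.\<close>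

lemma ex_Arg_between_iff:
  assumes "\<alpha> < \<beta>" "\<beta> < \<alpha> + pi"
  shows "v = 0 \<or> (\<exists>\<theta>\<in>{\<alpha>..\<beta>}. is_Arg v \<theta>) \<longleftrightarrow>
    0 \<le> Im (v * cis (- \<alpha>)) \<and> Im (v * cis (- \<beta>)) \<le> 0" (is "?L \<longleftrightarrow> ?R")
proof
  assume ?L
  then show ?R
  proof
    assume "\<exists>\<theta>\<in>{\<alpha>..\<beta>}. is_Arg v \<theta>"
    then obtain \<theta> where t: "\<alpha> \<le> \<theta>" "\<theta> \<le> \<beta>" and v: "v = of_real (norm v) * cis \<theta>"
      by (auto simp: is_Arg_iff_cis)
    have "Im (v * cis (- \<gamma>)) = norm v * sin (\<theta> - \<gamma>)" for \<gamma>
      using arg_cong[OF v, of "\<lambda>z. Im (z * cis (- \<gamma>))"]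
      by (simp add: mult.assoc cis_mult del: times_complex.sel) simp
    moreover have "0 \<le> sin (\<theta> - \<alpha>)"
      using t assms by (intro sin_ge_zero) auto
    moreover have "0 \<le> sin (\<beta> - \<theta>)"
      using t assms by (intro sin_ge_zero) auto
    then have "sin (\<theta> - \<beta>) \<le> 0"
      using sin_minus[of "\<beta> - \<theta>"] by simp
    ultimately show ?R by (simp add: mult_nonneg_nonpos)
  qed simp
next
  assume R: ?R
  show ?L
  proof (cases "v = 0")
    case False
    \<comment> \<open>The argument is measured from the side \<open>\<alpha>\<close>; it has to end
      up between \<open>0\<close> and \<open>\<beta> - \<alpha>\<close>.\<close>
    define \<phi> where "\<phi> = Arg (v * cis (- \<alpha>))"
    have "is_Arg (v * cis (- \<alpha>)) \<phi>"
      unfolding \<phi>_def using False by (intro is_Arg_Arg) simp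
    then have eq: "v * cis (- \<alpha>) = of_real (norm v) * cis \<phi>"
      by (simp add: is_Arg_iff_cis norm_mult)
    have v: "v = of_real (norm v) * cis (\<alpha> + \<phi>)"
    proof -
      have "v = v * cis (- \<alpha>) * cis \<alpha>" by (simp add: mult.assoc cis_mult)
      then show ?thesis by (simp add: eq mult.assoc cis_mult add.commute)
    qed
    have Im_eq: "Im (v * cis (- \<gamma>)) = norm v * sin (\<alpha> + \<phi> - \<gamma>)" for \<gamma>
      using arg_cong[OF v, of "\<lambda>z. Im (z * cis (- \<gamma>))"]
      by (simp add: mult.assoc cis_mult del: times_complex.sel) simp
    have \<phi>: "- pi < \<phi>" "\<phi> \<le> pi"
      unfolding \<phi>_def using mpi_less_Arg Arg_le_pi by auto
    have s: "0 \<le> sin \<phi>" "sin (\<phi> + \<alpha> - \<beta>) \<le> 0"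
      using R False by (simp_all add: Im_eq zero_le_mult_iff mult_le_0_iff add.commute del: times_complex.sel)
    have "0 \<le> \<phi>"
      using s(1) \<phi> sin_gt_zero[of "- \<phi>"] by (force simp: not_le)
    moreover have "\<phi> + \<alpha> \<le> \<beta>"
      using s(2) \<phi> assms sin_gt_zero[of "\<phi> + \<alpha> - \<beta>"] by force
    ultimately show ?thesis
      using v by (intro disjI2 bexI[of _ "\<alpha> + \<phi>"]) (auto simp: is_Arg_iff_cis)
  qed simp
qed

text \<open>Brouwer's theorem for \<open>p + G p\<close> on the ball of radius \<open>R\<close>,
  whose fixed points are the zeros of \<open>G\<close>. If \<open>norm p \<le> R - m\<close>, a
  displacement of length at most \<open>m\<close> stays in the ball; farther out,
  \<open>inward\<close> ensures that the displacement does not increase the norm.\<close>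

lemma bounded_inward_field_has_zero:
  fixes G :: "'a::euclidean_space \<Rightarrow> 'a"
  assumes cont: "continuous_on UNIV G" and m: "0 \<le> m" and R: "m \<le> R"
    and norm: "\<And>p. norm (G p) \<le> m"
    and inward: "\<And>p. R - m \<le> norm p \<Longrightarrow> 2 * (G p \<bullet> p) + m\<^sup>2 \<le> 0"
  shows "\<exists>p. G p = 0"
proof -
  have "norm (p + G p) \<le> R" if "norm p \<le> R" for p
  proof (cases "norm p \<le> R - m")
    case True
    then show ?thesis using norm_triangle_ineq[of p "G p"] norm[of p] by linarith
  next
    case False
    have "(norm (p + G p))\<^sup>2 = (norm p)\<^sup>2 + 2 * (G p \<bullet> p) + (norm (G p))\<^sup>2"
      by (simp add: power2_norm_eq_inner inner_add_left inner_add_right inner_commute)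
    also have "\<dots> \<le> (norm p)\<^sup>2 + 2 * (G p \<bullet> p) + m\<^sup>2"
      using power_mono[OF norm norm_ge_zero, where n = 2] by simp
    also have "\<dots> \<le> R\<^sup>2"
      using inward[of p] False power_mono[OF that, of 2] by simp
    finally show ?thesis using m R by (simp add: power2_le_iff_abs_le)
  qed
  then have "(\<lambda>p. p + G p) \<in> cball 0 R \<rightarrow> cball 0 R"
    by simp
  moreover have "continuous_on (cball 0 R) (\<lambda>p. p + G p)"
    by (intro continuous_intros continuous_on_subset[OF cont]) simp
  moreover have "cball (0 :: 'a) R \<noteq> {}"
    using m R by simp
  ultimately obtain p where "p + G p = p"
    using brouwer[OF compact_cball convex_cball] by blast
  then show ?thesis by auto
qed

section \<open>Three sectors of fixed direction with a moving apex\<close>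

context line_null_measure
begin

text \<open>In linear inequalities, these are the sectors at the apex \<open>p\<close> with
  arguments from \<open>0\<close> to \<open>2 * pi / 3\<close>, on to \<open>4 * pi / 3\<close> and
  on to \<open>2 * pi\<close>.\<close>

lemma ex_three_sectors_equipartition:
  defines "m \<equiv> measure \<nu> UNIV"
  shows "\<exists>p. measure \<nu> {w. 0 \<le> Im (w - p) \<and> 0 \<le> Im (w - p) + sqrt 3 * Re (w - p)} = m / 3
    \<and> measure \<nu> {w. Im (w - p) + sqrt 3 * Re (w - p) \<le> 0 \<and> sqrt 3 * Re (w - p) - Im (w - p) \<le> 0} = m / 3
    \<and> measure \<nu> {w. 0 \<le> sqrt 3 * Re (w - p) - Im (w - p) \<and> Im (w - p) \<le> 0} = m / 3"
proof (cases "m = 0")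
  case True
  then have "measure \<nu> A = 0" for A
    by (metis m_def bounded_measure measure_nonneg order_antisym space_UNIV)
  then show ?thesis using True by simp
next
  case False
  then have m: "m > 0" by (simp add: m_def zero_less_measure_iff)
  define A0 where "A0 = {v. 0 \<le> Im v \<and> 0 \<le> Im v + sqrt 3 * Re v}"
  define A1 where "A1 = {v. Im v + sqrt 3 * Re v \<le> 0 \<and> sqrt 3 * Re v - Im v \<le> 0}"
  define A2 where "A2 = {v. 0 \<le> sqrt 3 * Re v - Im v \<and> Im v \<le> 0}"
  define u0 u1 u2 where "u0 = Complex (1 / 2) (sqrt 3 / 2)" and "u1 = (- 1 :: complex)"
    and "u2 = Complex (1 / 2) (- sqrt 3 / 2)"
  have norm_u: "norm u0 = 1" "norm u1 = 1" "norm u2 = 1"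
    by (simp_all add: u0_def u1_def u2_def cmod_def power_divide)
  \<comment> \<open>Vectors of a sector make an angle of at most \<open>pi / 3\<close> with its
    bisector \<open>u\<close>, and \<open>cos (pi / 3)\<close> is \<open>1 / 2\<close>. In squared
    form, \<open>(2 * (u \<bullet> v))\<^sup>2 - (norm v)\<^sup>2\<close> is, up to a positive
    factor and sign, the product of the two linear forms that define the sector.\<close>
  have cone: "norm v / 2 \<le> u \<bullet> v"
    if "0 \<le> u \<bullet> v" "(Re v)\<^sup>2 + (Im v)\<^sup>2 \<le> (2 * (u \<bullet> v))\<^sup>2" for u v
  proof -
    have "norm v \<le> 2 * (u \<bullet> v)"
      unfolding cmod_def using that by (intro real_le_lsqrt) auto
    then show ?thesis by simp
  qed
  have cone0: "norm v / 2 \<le> u0 \<bullet> v" if "v \<in> A0" for v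
  proof (rule cone)
    have "0 \<le> sqrt 3 * (sqrt 3 * Im v + Re v)"
      using that by (simp add: A0_def algebra_simps)
    then have "0 \<le> sqrt 3 * Im v + Re v" by (simp add: zero_le_mult_iff)
    then show "0 \<le> u0 \<bullet> v" by (simp add: u0_def inner_complex_def)
    have "0 \<le> Im v * (Im v + sqrt 3 * Re v)" using that by (simp add: A0_def)
    then show "(Re v)\<^sup>2 + (Im v)\<^sup>2 \<le> (2 * (u0 \<bullet> v))\<^sup>2"
      by (simp add: u0_def inner_complex_def power2_eq_square algebra_simps)
  qed
  have cone1: "norm v / 2 \<le> u1 \<bullet> v" if "v \<in> A1" for v
  proof (rule cone)
    have "sqrt 3 * Re v \<le> 0" using that by (simp add: A1_def)
    then show "0 \<le> u1 \<bullet> v" by (simp add: u1_def inner_complex_def mult_le_0_iff)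
    have "0 \<le> (Im v + sqrt 3 * Re v) * (sqrt 3 * Re v - Im v)"
      using that by (simp add: A1_def mult_nonpos_nonpos)
    then show "(Re v)\<^sup>2 + (Im v)\<^sup>2 \<le> (2 * (u1 \<bullet> v))\<^sup>2"
      by (simp add: u1_def inner_complex_def power2_eq_square algebra_simps)
  qed
  have cone2: "norm v / 2 \<le> u2 \<bullet> v" if "v \<in> A2" for v
  proof (rule cone)
    have "0 \<le> sqrt 3 * (Re v - sqrt 3 * Im v)"
      using that by (simp add: A2_def algebra_simps)
    then have "0 \<le> Re v - sqrt 3 * Im v" by (simp add: zero_le_mult_iff)
    then show "0 \<le> u2 \<bullet> v" by (simp add: u2_def inner_complex_def)
    have "0 \<le> - Im v * (sqrt 3 * Re v - Im v)" using that by (simp add: A2_def mult_nonpos_nonneg)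
    then show "(Re v)\<^sup>2 + (Im v)\<^sup>2 \<le> (2 * (u2 \<bullet> v))\<^sup>2"
      by (simp add: u2_def inner_complex_def power2_eq_square algebra_simps)
  qed
  have meas [measurable]: "A0 \<in> sets borel" "A1 \<in> sets borel" "A2 \<in> sets borel"
    unfolding A0_def A1_def A2_def by measurable
  \<comment> \<open>The lines \<open>Re (k * v) = 0\<close> for these three numbers carry the
    boundary rays of the sectors.\<close>
  define k0 k1 k2 where "k0 = - \<i>" and "k1 = Complex (sqrt 3) (- 1)" and "k2 = Complex (sqrt 3) 1"
  have k: "k0 \<noteq> 0" "k1 \<noteq> 0" "k2 \<noteq> 0"
    by (auto simp: k0_def k1_def k2_def complex_eq_iff)
  have Re_k: "Re (k0 * v) = Im v" "Re (k1 * v) = Im v + sqrt 3 * Re v"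
    "Re (k2 * v) = sqrt 3 * Re v - Im v" for v
    by (simp_all add: k0_def k1_def k2_def)
  \<comment> \<open>The horizontal line cuts the middle sector in two; each of the other sectors
    fills the rest of its half-plane. The predicate \<open>P\<close> allows the count over the whole
    plane, inside a ball and outside it.\<close>
  have sum_sectors: "measure \<nu> {w. P w \<and> w - p \<in> A0} + measure \<nu> {w. P w \<and> w - p \<in> A1}
      + measure \<nu> {w. P w \<and> w - p \<in> A2} = measure \<nu> {w. P w}"
    if [measurable]: "Measurable.pred borel P" for P p
  proof -
    have split: "measure \<nu> {w. Q w \<and> 0 \<le> Re (k * (w - p))} + measure \<nu> {w. Q w \<and> Re (k * (w - p)) \<le> 0}
      = measure \<nu> {w. Q w}" if "k \<noteq> 0" "Measurable.pred borel Q" for k Q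
      using measure_split_line[OF that, of "Re (k * p)"] by (simp add: right_diff_distrib del: times_complex.sel)
    let ?y = "\<lambda>w. Im (w - p)" and ?s = "\<lambda>w. sqrt 3 * Re (w - p)"
    have 1: "measure \<nu> {w. P w \<and> 0 \<le> ?y w} + measure \<nu> {w. P w \<and> ?y w \<le> 0} = measure \<nu> {w. P w}"
      using split[OF k(1), of P] by (simp only: Re_k that)
    have 2: "measure \<nu> {w. P w \<and> w - p \<in> A0} + measure \<nu> {w. P w \<and> w - p \<in> A1 \<and> 0 \<le> ?y w}
      = measure \<nu> {w. P w \<and> 0 \<le> ?y w}"
    proof -
      have "measure \<nu> {w. (P w \<and> 0 \<le> ?y w) \<and> 0 \<le> ?y w + ?s w}
        + measure \<nu> {w. (P w \<and> 0 \<le> ?y w) \<and> ?y w + ?s w \<le> 0} = measure \<nu> {w. P w \<and> 0 \<le> ?y w}"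
        using split[OF k(2), of "\<lambda>w. P w \<and> 0 \<le> ?y w"] unfolding Re_k by simp
      moreover have "{w. (P w \<and> 0 \<le> ?y w) \<and> 0 \<le> ?y w + ?s w} = {w. P w \<and> w - p \<in> A0}"
        "{w. (P w \<and> 0 \<le> ?y w) \<and> ?y w + ?s w \<le> 0} = {w. P w \<and> w - p \<in> A1 \<and> 0 \<le> ?y w}"
        unfolding A0_def A1_def by auto
      ultimately show ?thesis by simp
    qed
    have 3: "measure \<nu> {w. P w \<and> w - p \<in> A2} + measure \<nu> {w. P w \<and> w - p \<in> A1 \<and> ?y w \<le> 0}
      = measure \<nu> {w. P w \<and> ?y w \<le> 0}"
    proof -
      have "measure \<nu> {w. (P w \<and> ?y w \<le> 0) \<and> 0 \<le> ?s w - ?y w}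
        + measure \<nu> {w. (P w \<and> ?y w \<le> 0) \<and> ?s w - ?y w \<le> 0} = measure \<nu> {w. P w \<and> ?y w \<le> 0}"
        using split[OF k(3), of "\<lambda>w. P w \<and> ?y w \<le> 0"] unfolding Re_k by simp
      moreover have "{w. (P w \<and> ?y w \<le> 0) \<and> 0 \<le> ?s w - ?y w} = {w. P w \<and> w - p \<in> A2}"
        "{w. (P w \<and> ?y w \<le> 0) \<and> ?s w - ?y w \<le> 0} = {w. P w \<and> w - p \<in> A1 \<and> ?y w \<le> 0}"
        unfolding A2_def A1_def by auto
      ultimately show ?thesis by simp
    qed
    have "measure \<nu> {w. P w \<and> w - p \<in> A1 \<and> 0 \<le> ?y w} + measure \<nu> {w. P w \<and> w - p \<in> A1 \<and> ?y w \<le> 0}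
      = measure \<nu> {w. P w \<and> w - p \<in> A1}"
      using split[OF k(1), of "\<lambda>w. P w \<and> w - p \<in> A1"] unfolding Re_k by (simp add: conj_assoc)
    with 1 2 3 show ?thesis by linarith
  qed
  define h where "h A p = measure \<nu> {w. w - p \<in> A}" for A p
  have cont_h: "continuous_on UNIV (h A)" if "A \<in> {A0, A1, A2}" for A
  proof -
    have *: "continuous_on UNIV (\<lambda>p. measure \<nu> {w. Re (a * p) \<le> Re (a * w) \<and> Re (b * p) \<le> Re (b * w)})"
      if "a \<noteq> 0" "b \<noteq> 0" for a b
      using that by (intro continuous_on_measure_two_halfplanes continuous_intros) auto
    have A: "h A0 = (\<lambda>p. measure \<nu> {w. Re (k0 * p) \<le> Re (k0 * w) \<and> Re (k1 * p) \<le> Re (k1 * w)})"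
      "h A1 = (\<lambda>p. measure \<nu> {w. Re (- k1 * p) \<le> Re (- k1 * w) \<and> Re (- k2 * p) \<le> Re (- k2 * w)})"
      "h A2 = (\<lambda>p. measure \<nu> {w. Re (k2 * p) \<le> Re (k2 * w) \<and> Re (- k0 * p) \<le> Re (- k0 * w)})"
      unfolding h_def A0_def A1_def A2_def k0_def k1_def k2_def
      by (intro ext arg_cong[of _ _ "measure \<nu>"] Collect_cong; simp add: algebra_simps)+
    show ?thesis
      using that *[OF k(1,2)] *[of "- k1" "- k2"] *[of k2 "- k0"] k
      by (elim insertE emptyE) (simp_all only: A neg_equal_0_iff_equal simp_thms not_False_eq_True)
  qed
  define G where "G p = h A0 p *\<^sub>R u0 + h A1 p *\<^sub>R u1 + h A2 p *\<^sub>R u2" for p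
  have sum_h: "h A0 p + h A1 p + h A2 p = m" for p
    using sum_sectors[of "\<lambda>_. True" p] by (simp add: h_def m_def)
  \<comment> \<open>With \<beta> the mass of the ball, the estimate below has the coefficient
    \<open>3 / 2 * \<beta> - m\<close> at \<open>- norm p\<close>; the fraction \<open>5 / 6\<close>
    makes it at least \<open>m / 4\<close>.\<close>
  obtain r where r: "r > 0" "5 / 6 * m < measure \<nu> (ball 0 r)"
    using ex_ball_measure_gt[of "5 / 6 * m"] m by (auto simp: m_def)
  have inward: "G p \<bullet> p \<le> m * (3 / 2 * r - norm p / 4)" for p
  proof -
    define a where "a A = measure \<nu> {w. w \<in> ball 0 r \<and> w - p \<in> A}" for A
    define b where "b A = measure \<nu> {w. w \<notin> ball 0 r \<and> w - p \<in> A}" for A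
    \<comment> \<open>If the sector at \<open>p\<close> contains a point \<open>w\<close> of the
      ball, then \<open>u \<bullet> p\<close> is at most
      \<open>u \<bullet> w - norm (w - p) / 2\<close>, hence at most
      \<open>r - (norm p - r) / 2\<close>. For the mass outside the ball the trivial bound
      \<open>norm p\<close> is enough, as that mass is small.\<close>
    have bound: "h A p * (u \<bullet> p) \<le> a A * (3 / 2 * r - norm p / 2) + b A * norm p"
      if [measurable]: "A \<in> sets borel" and u: "norm u = 1"
        and c: "\<And>v. v \<in> A \<Longrightarrow> norm v / 2 \<le> u \<bullet> v" for A u
    proof -
      have "h A p = measure \<nu> ({w. w \<in> ball 0 r \<and> w - p \<in> A} \<union> {w. w \<notin> ball 0 r \<and> w - p \<in> A})"
        unfolding h_def by (rule arg_cong[of _ _ "measure \<nu>"]) auto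
      also have "\<dots> = a A + b A"
        unfolding a_def b_def by (rule finite_measure_Union) auto
      finally have h: "h A p = a A + b A" .
      have le: "u \<bullet> w \<le> norm w" for w
        using norm_cauchy_schwarz[of u w] u by simp
      have "a A * (u \<bullet> p) \<le> a A * (3 / 2 * r - norm p / 2)"
      proof (cases "{w. w \<in> ball 0 r \<and> w - p \<in> A} = {}")
        case True
        then show ?thesis unfolding a_def by (simp only: measure_empty mult_zero_left order_refl)
      next
        case False
        then obtain w where w: "norm w < r" "w - p \<in> A" by auto
        have "norm p - norm w \<le> norm (w - p)"
          using norm_triangle_ineq2[of p w] by (simp add: norm_minus_commute)
        then have "u \<bullet> p \<le> 3 / 2 * r - norm p / 2"
          using c[OF w(2)] w(1) le[of w] by (simp add: inner_diff_right)
        then show ?thesis by (intro mult_left_mono) (simp_all add: a_def)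
      qed
      moreover have "b A * (u \<bullet> p) \<le> b A * norm p"
        by (intro mult_left_mono le) (simp add: b_def)
      ultimately show ?thesis by (simp add: h distrib_right)
    qed
    have bound0: "h A0 p * (u0 \<bullet> p) \<le> a A0 * (3 / 2 * r - norm p / 2) + b A0 * norm p"
      by (rule bound[OF meas(1) norm_u(1)]) (rule cone0)
    have bound1: "h A1 p * (u1 \<bullet> p) \<le> a A1 * (3 / 2 * r - norm p / 2) + b A1 * norm p"
      by (rule bound[OF meas(2) norm_u(2)]) (rule cone1)
    have bound2: "h A2 p * (u2 \<bullet> p) \<le> a A2 * (3 / 2 * r - norm p / 2) + b A2 * norm p"
      by (rule bound[OF meas(3) norm_u(3)]) (rule cone2)
    define \<beta> where "\<beta> = measure \<nu> (ball 0 r)"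
    have sa: "a A0 + a A1 + a A2 = \<beta>"
      using sum_sectors[of "\<lambda>w. w \<in> ball 0 r" p] unfolding a_def \<beta>_def by (simp only: Collect_mem_eq) simp
    have "b A0 + b A1 + b A2 = measure \<nu> (- ball 0 r)"
      using sum_sectors[of "\<lambda>w. w \<notin> ball 0 r" p] unfolding b_def Compl_eq by simp
    also have "\<dots> = m - \<beta>"
      using finite_measure_compl[of "ball 0 r"] by (simp add: m_def \<beta>_def Compl_eq_Diff_UNIV)
    finally have sb: "b A0 + b A1 + b A2 = m - \<beta>" .
    have "G p \<bullet> p = h A0 p * (u0 \<bullet> p) + h A1 p * (u1 \<bullet> p) + h A2 p * (u2 \<bullet> p)"
      by (simp add: G_def inner_add_left)
    also have "\<dots> \<le> (a A0 + a A1 + a A2) * (3 / 2 * r - norm p / 2) + (b A0 + b A1 + b A2) * norm p"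
      using bound0 bound1 bound2 unfolding distrib_right by linarith
    also have "\<dots> = 3 / 2 * r * \<beta> - norm p * (3 / 2 * \<beta> - m)"
      unfolding sa sb by (simp add: algebra_simps)
    also have "\<dots> \<le> 3 / 2 * r * m - norm p * (m / 4)"
    proof (intro diff_mono mult_left_mono)
      show "\<beta> \<le> m" unfolding \<beta>_def m_def using bounded_measure by simp
    qed (use r in \<open>auto simp: \<beta>_def\<close>)
    finally show ?thesis by (simp add: algebra_simps)
  qed
  \<comment> \<open>The radius is chosen so that \<open>R - m = 6 * r + 2 * m\<close>: from there on
    \<open>3 / 2 * r - norm p / 4\<close> is at most \<open>- m / 2\<close>, which is what the
    inward condition asks for.\<close>
  have "\<exists>p. G p = 0"
  proof (rule bounded_inward_field_has_zero[where m = m and R = "6 * r + 3 * m"])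
    show "continuous_on UNIV G"
      unfolding G_def by (intro continuous_intros cont_h) auto
    show "norm (G p) \<le> m" for p
    proof -
      have "norm (G p) \<le> norm (h A0 p *\<^sub>R u0) + norm (h A1 p *\<^sub>R u1) + norm (h A2 p *\<^sub>R u2)"
        unfolding G_def by (intro norm_triangle_le add_mono norm_triangle_ineq order_refl)
      also have "\<dots> = m"
        using sum_h[of p] by (simp add: norm_u h_def)
      finally show ?thesis .
    qed
    show "2 * (G p \<bullet> p) + m\<^sup>2 \<le> 0" if "6 * r + 3 * m - m \<le> norm p" for p
    proof -
      have "m * (3 / 2 * r - norm p / 4) \<le> m * (- m / 2)"
        using that m by (intro mult_left_mono) auto
      then show ?thesis using inward[of p] by (simp add: power2_eq_square)
    qed
  qed (use m r in auto)
  then obtain p where p: "G p = 0" ..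
  have "Re (G p) = 0" "Im (G p) = 0" by (simp_all add: p)
  then have "h A0 p = h A2 p" "h A0 p + h A2 p = 2 * h A1 p"
    by (simp_all add: G_def u0_def u1_def u2_def)
  with sum_h[of p] have "h A0 p = m / 3" "h A1 p = m / 3" "h A2 p = m / 3"
    by linarith+
  then show ?thesis
    unfolding h_def A0_def A1_def A2_def by (intro exI[of _ p]) (simp only: mem_Collect_eq)
qed

end

section \<open>Planar fans for both values of \<open>q\<close>\<close>

lemma cis_thirds:
  "cis (- (2 * pi / 3)) = Complex (- 1 / 2) (- sqrt 3 / 2)"
  "cis (- (4 * pi / 3)) = Complex (- 1 / 2) (sqrt 3 / 2)"
proof -
  have "2 * pi / 3 = pi - pi / 3" "4 * pi / 3 = pi + pi / 3" by simp_all
  then have "cos (2 * pi / 3) = - (1 / 2)" "sin (2 * pi / 3) = sqrt 3 / 2"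
    "cos (4 * pi / 3) = - (1 / 2)" "sin (4 * pi / 3) = - (sqrt 3 / 2)"
    by (simp_all only: cos_diff sin_diff cos_add sin_add cos_60 sin_60) simp_all
  then show "cis (- (2 * pi / 3)) = Complex (- 1 / 2) (- sqrt 3 / 2)"
    "cis (- (4 * pi / 3)) = Complex (- 1 / 2) (sqrt 3 / 2)"
    by (simp_all add: complex_eq_iff)
qed

lemma cis_quarters:
  "cis (- (pi / 2)) = - \<i>" "cis (- pi) = - 1" "cis (- (3 * pi / 2)) = \<i>"
proof -
  have "3 * pi / 2 = pi + pi / 2" by simp
  then have "cos (3 * pi / 2) = 0" "sin (3 * pi / 2) = - 1"
    by (simp_all only: cos_add sin_add) simp_all
  then show "cis (- (pi / 2)) = - \<i>" "cis (- pi) = - 1" "cis (- (3 * pi / 2)) = \<i>"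
    by (simp_all add: complex_eq_iff)
qed

text \<open>Translates the linear inequalities back into arguments. The phase \<open>u\<close> is
  \<open>1\<close> for \<open>q = 3\<close> and the direction \<open>cis t\<close> for
  \<open>q = 4\<close>; it will become the phase of the normal vector.\<close>

lemma (in line_null_measure) ex_equipartition_sectors:
  assumes "q \<in> {3, 4}"
  shows "\<exists>u p. norm u = 1 \<and> (\<forall>j<q. measure \<nu>
    {w. u * w - p = 0 \<or>
        (\<exists>\<theta>\<in>{2 * pi * real j / real q..2 * pi * real (j + 1) / real q}. is_Arg (u * w - p) \<theta>)}
    = 1 / real q * measure \<nu> UNIV)"
proof -
  \<comment> \<open>The width \<open>2 * pi / q\<close> is below \<open>pi\<close>, so the
    description by half-planes applies.\<close>
  have sector: "(v = 0 \<or> (\<exists>\<theta>\<in>{2 * pi * real j / real q..2 * pi * real (j + 1) / real q}. is_Arg v \<theta>)) \<longleftrightarrow>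
      0 \<le> Im (v * cis (- (2 * pi * real j / real q))) \<and> Im (v * cis (- (2 * pi * real (j + 1) / real q))) \<le> 0"
    for v j
    using assms by (intro ex_Arg_between_iff) (auto simp: field_simps)
  consider "q = 3" | "q = 4" using assms by blast
  then show ?thesis
  proof cases
    case 1
    obtain p where p:
      "measure \<nu> {w. 0 \<le> Im (w - p) \<and> 0 \<le> Im (w - p) + sqrt 3 * Re (w - p)} = measure \<nu> UNIV / 3"
      "measure \<nu> {w. Im (w - p) + sqrt 3 * Re (w - p) \<le> 0 \<and> sqrt 3 * Re (w - p) - Im (w - p) \<le> 0}
        = measure \<nu> UNIV / 3"
      "measure \<nu> {w. 0 \<le> sqrt 3 * Re (w - p) - Im (w - p) \<and> Im (w - p) \<le> 0} = measure \<nu> UNIV / 3"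
      using ex_three_sectors_equipartition by blast
    have s: "0 \<le> Im (v * cis (- (2 * pi * real 0 / real 3))) \<and> Im (v * cis (- (2 * pi * real (0 + 1) / real 3))) \<le> 0
        \<longleftrightarrow> 0 \<le> Im v \<and> 0 \<le> Im v + sqrt 3 * Re v"
      "0 \<le> Im (v * cis (- (2 * pi * real 1 / real 3))) \<and> Im (v * cis (- (2 * pi * real (1 + 1) / real 3))) \<le> 0
        \<longleftrightarrow> Im v + sqrt 3 * Re v \<le> 0 \<and> sqrt 3 * Re v - Im v \<le> 0"
      "0 \<le> Im (v * cis (- (2 * pi * real 2 / real 3))) \<and> Im (v * cis (- (2 * pi * real (2 + 1) / real 3))) \<le> 0
        \<longleftrightarrow> 0 \<le> sqrt 3 * Re v - Im v \<and> Im v \<le> 0" for v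
      using cis_thirds by (auto simp: algebra_simps)
    have "\<forall>j<q. measure \<nu>
      {w. w - p = 0 \<or>
        (\<exists>\<theta>\<in>{2 * pi * real j / real q..2 * pi * real (j + 1) / real q}. is_Arg (w - p) \<theta>)}
      = 1 / real q * measure \<nu> UNIV"
    proof (intro allI impI)
      fix j assume "j < q"
      then consider "j = 0" | "j = 1" | "j = 2" using 1 by linarith
      then show "measure \<nu>
        {w. w - p = 0 \<or>
          (\<exists>\<theta>\<in>{2 * pi * real j / real q..2 * pi * real (j + 1) / real q}. is_Arg (w - p) \<theta>)}
        = 1 / real q * measure \<nu> UNIV"
        unfolding sector using p by cases (simp_all only: 1 s)
    qed
    then show ?thesis by (intro exI[of _ 1] exI[of _ p]) simp
  next
    case 2
    obtain t p where p:
      "measure \<nu> {w. 0 \<le> Re (cis t * w - p) \<and> 0 \<le> Im (cis t * w - p)} = measure \<nu> UNIV / 4"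
      "measure \<nu> {w. Re (cis t * w - p) \<le> 0 \<and> 0 \<le> Im (cis t * w - p)} = measure \<nu> UNIV / 4"
      "measure \<nu> {w. Re (cis t * w - p) \<le> 0 \<and> Im (cis t * w - p) \<le> 0} = measure \<nu> UNIV / 4"
      "measure \<nu> {w. 0 \<le> Re (cis t * w - p) \<and> Im (cis t * w - p) \<le> 0} = measure \<nu> UNIV / 4"
      using ex_perpendicular_lines_equipartition by blast
    have s: "0 \<le> Im (v * cis (- (2 * pi * real 0 / real 4))) \<and> Im (v * cis (- (2 * pi * real (0 + 1) / real 4))) \<le> 0
        \<longleftrightarrow> 0 \<le> Re v \<and> 0 \<le> Im v"
      "0 \<le> Im (v * cis (- (2 * pi * real 1 / real 4))) \<and> Im (v * cis (- (2 * pi * real (1 + 1) / real 4))) \<le> 0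
        \<longleftrightarrow> Re v \<le> 0 \<and> 0 \<le> Im v"
      "0 \<le> Im (v * cis (- (2 * pi * real 2 / real 4))) \<and> Im (v * cis (- (2 * pi * real (2 + 1) / real 4))) \<le> 0
        \<longleftrightarrow> Re v \<le> 0 \<and> Im v \<le> 0"
      "0 \<le> Im (v * cis (- (2 * pi * real 3 / real 4))) \<and> Im (v * cis (- (2 * pi * real (3 + 1) / real 4))) \<le> 0
        \<longleftrightarrow> 0 \<le> Re v \<and> Im v \<le> 0" for v
      using cis_quarters by (auto simp: algebra_simps)
    have "\<forall>j<q. measure \<nu>
      {w. cis t * w - p = 0 \<or>
        (\<exists>\<theta>\<in>{2 * pi * real j / real q..2 * pi * real (j + 1) / real q}. is_Arg (cis t * w - p) \<theta>)}
      = 1 / real q * measure \<nu> UNIV"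
    proof (intro allI impI)
      fix j assume "j < q"
      then consider "j = 0" | "j = 1" | "j = 2" | "j = 3" using 2 by linarith
      then show "measure \<nu>
        {w. cis t * w - p = 0 \<or>
          (\<exists>\<theta>\<in>{2 * pi * real j / real q..2 * pi * real (j + 1) / real q}. is_Arg (cis t * w - p) \<theta>)}
        = 1 / real q * measure \<nu> UNIV"
        unfolding sector using p by cases (simp_all only: 2 s)
    qed
    then show ?thesis by (intro exI[of _ "cis t"] exI[of _ p]) simp
  qed
qed

section \<open>Transfer from the plane to the coordinates of the complex plane squared\<close>

lemma AE_component_off_line:
  fixes \<mu> :: "(complex^2) measure"
  assumes "mass_distribution \<mu>" "k \<noteq> 0"
  shows "AE z in \<mu>. Re (k * z $ i) \<noteq> d"
proof -
  \<comment> \<open>The preimage of a line under a coordinate is a real hyperplane, hence Lebesgue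
    null.\<close>
  have eq: "Re (k * z $ i) = axis i (cnj k) \<bullet> z" for z :: "complex^2"
    by (simp add: inner_axis' inner_complex_def)
  let ?L = "{z :: complex^2. axis i (cnj k) \<bullet> z = d}"
  have "negligible ?L"
    using assms(2) by (intro negligible_hyperplane) (simp add: axis_eq_0_iff)
  then have "?L \<in> null_sets lborel"
    by (subst null_sets_completion_iff[symmetric])
       (simp_all add: negligible_iff_null_sets closed_hyperplane borel_closed)
  then have "?L \<in> null_sets \<mu>"
    using assms(1) by (auto simp: mass_distribution_def absolutely_continuous_def)
  then show ?thesis
    by (rule AE_I') (auto simp: eq simp del: times_complex.sel)
qed

text \<open>For a normal vector on the axis \<open>i\<close>, membership in a sector depends only on
  \<open>z $ i\<close>, so the planar result for the push-forward \<open>\<nu>\<close>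
  applies.\<close>

lemma ex_axis_fan_equipartitions:
  assumes q: "q \<in> {3, 4}" and \<mu>: "mass_distribution \<mu>"
  shows "\<exists>u b. norm u = 1 \<and> equipartitions q (axis i u) b \<mu>"
proof -
  interpret finite_measure \<mu> using \<mu> by (simp add: mass_distribution_def)
  have sets [measurable_cong]: "sets \<mu> = sets borel" using \<mu> by (simp add: mass_distribution_def)
  have space: "space \<mu> = UNIV" using sets_eq_imp_space_eq[OF sets] by simp
  have [measurable]: "(\<lambda>z. z $ i) \<in> borel_measurable \<mu>"
    by (subst measurable_cong_sets[OF sets refl]) (intro borel_measurable_continuous_onI continuous_intros)
  define \<nu> where "\<nu> = distr \<mu> borel (\<lambda>z. z $ i)"
  interpret \<nu>: line_null_measure \<nu>
  proof (intro line_null_measure.intro line_null_measure_axioms.intro)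
    show "finite_measure \<nu>" unfolding \<nu>_def by (rule finite_measure_distr) measurable
    show "AE w in \<nu>. Re (k * w) \<noteq> d" if "k \<noteq> 0" for k d
      unfolding \<nu>_def by (subst AE_distr_iff) (use AE_component_off_line[OF \<mu> that] in measurable)
  qed (simp add: \<nu>_def)
  have meas: "measure \<nu> S = measure \<mu> {z. z $ i \<in> S}" if "S \<in> sets borel" for S
    unfolding \<nu>_def using that by (subst measure_distr) (auto simp: space vimage_def)
  obtain u p where u: "norm u = 1" and eq: "\<And>j. j < q \<Longrightarrow> measure \<nu>
    {w. u * w - p = 0 \<or>
        (\<exists>\<theta>\<in>{2 * pi * real j / real q..2 * pi * real (j + 1) / real q}. is_Arg (u * w - p) \<theta>)}
    = 1 / real q * measure \<nu> UNIV"
    using \<nu>.ex_equipartition_sectors[OF q] by blast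
  \<comment> \<open>The form conjugates its second argument, and the definition of a sector
    conjugates the offset; this is why the witnesses are \<open>cnj u\<close> and
    \<open>cnj p\<close>.\<close>
  have herm: "hermitian_form z (axis i (cnj u)) = u * z $ i" for z
    by (simp add: hermitian_form_def axis_def if_distrib[of cnj] if_distrib[of "(*) _"] mult.commute cong: if_cong)
  have "measure \<mu> (regular_sector q (axis i (cnj u)) (cnj p) j) = 1 / real q * measure \<mu> UNIV" if "j < q" for j
  proof -
    let ?S = "{w. u * w - p = 0 \<or>
        (\<exists>\<theta>\<in>{2 * pi * real j / real q..2 * pi * real (j + 1) / real q}. is_Arg (u * w - p) \<theta>)}"
    have "regular_sector q (axis i (cnj u)) (cnj p) j = {z. z $ i \<in> ?S}"
    proof -
      have "u * z $ i = cnj (cnj p) + v \<longleftrightarrow> v = u * z $ i - p" for z v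
        by auto
      then show ?thesis unfolding regular_sector_def herm by simp
    qed
    moreover have "?S \<in> sets borel"
    proof -
      have "?S = {w. 0 \<le> Im ((u * w - p) * cis (- (2 * pi * real j / real q))) \<and>
        Im ((u * w - p) * cis (- (2 * pi * real (j + 1) / real q))) \<le> 0}"
        using q by (intro Collect_cong ex_Arg_between_iff) (auto simp: field_simps)
      then show ?thesis by (simp del: times_complex.sel)
    qed
    ultimately show ?thesis
      using eq[OF that] meas[of ?S] meas[of UNIV] by simp
  qed
  then show ?thesis
    using u by (intro exI[of _ "cnj u"] exI[of _ "cnj p"]) (simp add: equipartitions_def)
qed

theorem mainTheorem5:
  fixes q :: nat and \<mu> :: "(complex^2) measure"
  assumes "q \<in> {3, 4}"
    and "mass_distribution \<mu>"
  shows "\<exists>F a b F' a' b'.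
           complex_regular_fan q F a b \<and> complex_regular_fan q F' a' b' \<and>
           complex_orthogonal a a' \<and>
           equipartitions q a b \<mu> \<and> equipartitions q a' b' \<mu>"
proof -
  \<comment> \<open>Normals on different axes are orthogonal for all phases, so the two fans can be
    chosen independently.\<close>
  obtain u b u' b' where "norm u = 1" "equipartitions q (axis 1 u) b \<mu>"
    and "norm u' = 1" "equipartitions q (axis 2 u') b' \<mu>"
    using ex_axis_fan_equipartitions[OF assms] by metis
  moreover have "norm (axis i v :: complex^2) = norm v" for i v
    by (simp add: norm_eq_sqrt_inner inner_axis_axis)
  moreover have "complex_orthogonal (axis 1 u) (axis 2 u')"
    by (simp add: complex_orthogonal_def hermitian_form_def sum_2 axis_def)
  ultimately show ?thesis
    unfolding complex_regular_fan_def by metis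
qed

end
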